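(* i) For every $r,n\in\mathbb{N}$, $$\varrho_r(n)=\sum_{d\,\|\,n}\phi_r(d).$$ ii) For every $r\in\mathbb{N}$ the function $n\mapsto\varrho_r(n)$ is multiplicative, and for every prime power $p^{\nu}$ ($p$ prime, $\nu\in\mathbb{N}$), $$\varrho_r(p^{\nu})=p^{r\nu}-p^{r(\nu-1)}+1.$$
   Context: $\mathbb{N}=\{1,2,\ldots\}$. An integer $k$ is called regular (mod $n$) if there exists $x\in\mathbb{Z}$ with $k^2x\equiv k \pmod n$. The notation $d\,\|\,n$ means that $d$ is a unitary divisor of $n$, i.e. $d\ge 1$, $d\mid n$ and $\gcd(d,n/d)=1$. For $r,n\in\mathbb{N}$, $\varrho_r(n)$ denotes the number of ordered $r$-tuples $(k_1,\ldots,k_r)\in\{1,\ldots,n\}^r$ such that $\gcd(k_1,\ldots,k_r)$ is regular (mod $n$). $\phi_r$ is the Jordan function: $\phi_r(n)$ is the number of ordered $r$-tuples $(k_1,\ldots,k_r)\in\{1,\ldots,n\}^r$ such that $\gcd(k_1,\ldots,k_r)$ is coprime to $n$. An arithmetic function $f$ is multiplicative if $f(1)=1$ and $f(mn)=f(m)f(n)$ whenever $\gcd(m,n)=1$. *)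

theory Defs
  imports "HOL-Number_Theory.Number_Theory"
begin

definition regular_mod :: "int \<Rightarrow> int \<Rightarrow> bool" where
  "regular_mod n k \<longleftrightarrow> (\<exists>x::int. [k\<^sup>2 * x = k] (mod n))"

definition unitary_divisor :: "nat \<Rightarrow> nat \<Rightarrow> bool" where
  "unitary_divisor d n \<longleftrightarrow> d \<ge> 1 \<and> d dvd n \<and> gcd d (n div d) = 1"

text \<open>Ordered \<open>r\<close>-tuples with entries in \<open>{1..n}\<close> are lists of length \<open>r\<close>;
  the gcd of a tuple \<open>ks\<close> is \<open>Gcd (set ks)\<close>.\<close>

definition tuples :: "nat \<Rightarrow> nat \<Rightarrow> nat list set" where
  "tuples r n = {ks. length ks = r \<and> set ks \<subseteq> {1..n}}"

definition regular_count :: "nat \<Rightarrow> nat \<Rightarrow> nat" where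
  "regular_count r n = card {ks \<in> tuples r n. regular_mod (int n) (int (Gcd (set ks)))}"

definition jordan_totient :: "nat \<Rightarrow> nat \<Rightarrow> nat" where
  "jordan_totient r n = card {ks \<in> tuples r n. coprime (Gcd (set ks)) n}"

text \<open>Arithmetic functions live on the positive integers, so the value at \<open>0\<close> is
  left unconstrained.\<close>

definition multiplicative_arith :: "(nat \<Rightarrow> 'a::comm_semiring_1) \<Rightarrow> bool" where
  "multiplicative_arith f \<longleftrightarrow>
     f 1 = 1 \<and> (\<forall>m n. m \<ge> 1 \<longrightarrow> n \<ge> 1 \<longrightarrow> gcd m n = 1 \<longrightarrow> f (m * n) = f m * f n)"

end

theory Submission
  imports Defs
begin

text \<open>
  With \<open>d = gcd k n\<close>, the congruence \<open>k\<^sup>2 x \<equiv> k\<close> modulo \<open>n\<close> cancels to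
  \<open>k x \<equiv> 1\<close> modulo \<open>n / d\<close>; hence \<open>k\<close> is regular modulo \<open>n\<close> iff \<open>d\<close> is a unitary
  divisor of \<open>n\<close>. Classifying the tuples by the value of \<open>d\<close> for their gcd, and dividing
  all entries by \<open>d\<close>, the class of \<open>d\<close> has \<open>\<phi>\<^sub>r(n / d)\<close> elements, and
  \<open>d \<mapsto> n / d\<close> permutes the unitary divisors. Regularity of the gcd of a tuple depends
  only on the residues of its entries and can be tested separately modulo coprime factors, so
  multiplicativity follows from the Chinese remainder theorem. A prime power has only
  the two trivial unitary divisors.
\<close>

section \<open>Regularity, unitary divisors and coprime moduli\<close>

lemma regular_mod_iff_coprime:
  fixes n k :: int
  assumes "n > 0"
  shows "regular_mod n k \<longleftrightarrow> coprime (gcd k n) (n div gcd k n)"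
proof -
  define d where "d = gcd k n"
  define e where "e = n div d"
  define k' where "k' = k div d"
  have "d > 0" using assms by (simp add: d_def)
  have n: "n = d * e" and k: "k = d * k'"
    by (simp_all add: d_def e_def k'_def)
  have "coprime k' e"
    unfolding k'_def e_def d_def using assms by (intro div_gcd_coprime) auto
  have "regular_mod n k \<longleftrightarrow> (\<exists>x. [k * x = 1] (mod e))"
  proof -
    have "[k\<^sup>2 * x = k] (mod n) \<longleftrightarrow> [k * x = 1] (mod e)" for x
    proof -
      have "k\<^sup>2 * x - k = d * (k' * (k * x - 1))"
        by (subst (2 3) k) (simp add: k power2_eq_square algebra_simps)
      then have "[k\<^sup>2 * x = k] (mod n) \<longleftrightarrow> e dvd k' * (k * x - 1)"
        using \<open>d > 0\<close> by (simp add: cong_iff_dvd_diff n)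
      also have "\<dots> \<longleftrightarrow> [k * x = 1] (mod e)"
        using \<open>coprime k' e\<close>
        by (simp add: cong_iff_dvd_diff coprime_dvd_mult_right_iff coprime_commute)
      finally show ?thesis .
    qed
    then show ?thesis by (simp add: regular_mod_def)
  qed
  also have "\<dots> \<longleftrightarrow> coprime k e"
    by (simp add: coprime_iff_invertible_int)
  also have "\<dots> \<longleftrightarrow> coprime d e"
    using \<open>coprime k' e\<close> by (simp add: k)
  finally show ?thesis by (simp add: d_def e_def)
qed

lemma unitary_divisor_iff_coprime:
  "unitary_divisor d n \<longleftrightarrow> d \<ge> 1 \<and> d dvd n \<and> coprime d (n div d)"
  by (simp only: unitary_divisor_def coprime_iff_gcd_eq_1)

lemma regular_mod_iff_unitary_divisor:
  assumes "n \<ge> 1"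
  shows "regular_mod (int n) (int k) \<longleftrightarrow> unitary_divisor (gcd k n) n"
proof -
  have "gcd (int k) (int n) = int (gcd k n)" by simp
  then have "regular_mod (int n) (int k) \<longleftrightarrow> coprime (gcd k n) (n div gcd k n)"
    using assms by (simp only: regular_mod_iff_coprime of_nat_0_less_iff Suc_le_eq One_nat_def
        coprime_int_iff flip: zdiv_int)
  moreover have "gcd k n \<ge> 1" using assms by (simp add: Suc_le_eq)
  ultimately show ?thesis
    by (simp add: unitary_divisor_iff_coprime)
qed

text \<open>A solution modulo the product serves both factors; conversely, solutions
  \<open>x\<close> and \<open>y\<close> for the two factors are merged into one \<open>z\<close> by
  the Chinese remainder theorem.\<close>

lemma regular_mod_mult:
  assumes "coprime m n"
  shows "regular_mod (m * n) k \<longleftrightarrow> regular_mod m k \<and> regular_mod n k"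
proof
  assume "regular_mod (m * n) k"
  then show "regular_mod m k \<and> regular_mod n k"
    unfolding regular_mod_def by (meson cong_modulus_mult cong_dvd_modulus dvd_triv_right)
next
  assume "regular_mod m k \<and> regular_mod n k"
  then obtain x y where xy: "[k\<^sup>2 * x = k] (mod m)" "[k\<^sup>2 * y = k] (mod n)"
    by (auto simp: regular_mod_def)
  obtain z where z: "[z = x] (mod m)" "[z = y] (mod n)"
    using binary_chinese_remainder_int[OF assms] by blast
  have "[k\<^sup>2 * z = k] (mod m)" "[k\<^sup>2 * z = k] (mod n)"
    using z xy by (meson cong_scalar_left cong_trans)+
  then have "[k\<^sup>2 * z = k] (mod m * n)"
    using assms by (rule coprime_cong_mult)
  then show "regular_mod (m * n) k" by (auto simp: regular_mod_def)
qed

section \<open>Classifying tuples by the gcd with the modulus\<close>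

lemma finite_tuples [simp]: "finite (tuples r n)"
  using finite_lists_length_eq[of "{1..n}" r] by (simp add: tuples_def conj_commute)

lemma card_tuples: "card (tuples r n) = n ^ r"
  using card_lists_length_eq[of "{1..n}" r] by (simp add: tuples_def conj_commute)

lemma Gcd_set_map_mult: "Gcd (set (map ((*) d) js)) = (d::nat) * Gcd (set js)"
  by (simp add: Gcd_mult)

lemma inj_on_map_mult: "d > 0 \<Longrightarrow> inj_on (map ((*) (d::nat))) A"
  by (intro inj_on_subset[OF inj_mapI]) (auto intro: injI)

text \<open>Serves two counts: the class of tuples belonging to a given gcd, and the tuples whose
  entries are all divisible by a prime.\<close>

lemma tuples_multiples:
  assumes "d > 0"
  shows "{ks \<in> tuples r (d * n). d dvd Gcd (set ks)} = map ((*) d) ` tuples r n"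
proof (intro equalityI subsetI)
  fix ks assume "ks \<in> {ks \<in> tuples r (d * n). d dvd Gcd (set ks)}"
  then have ks: "ks \<in> tuples r (d * n)" "\<And>k. k \<in> set ks \<Longrightarrow> d dvd k"
    by (auto simp: dvd_Gcd_iff)
  have "k div d \<in> {1..n}" if "k \<in> set ks" for k
  proof -
    obtain j where "k = d * j" using ks(2) \<open>k \<in> set ks\<close> by blast
    moreover have "k \<in> {1..d * n}" using ks(1) that by (auto simp: tuples_def)
    ultimately show ?thesis using assms by simp
  qed
  then have "map (\<lambda>k. k div d) ks \<in> tuples r n"
    using ks(1) by (auto simp: tuples_def)
  moreover have "ks = map ((*) d) (map (\<lambda>k. k div d) ks)"
    using ks(2) by (simp add: map_idI)
  ultimately show "ks \<in> map ((*) d) ` tuples r n" by blast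
next
  fix ks assume "ks \<in> map ((*) d) ` tuples r n"
  then obtain js where "ks = map ((*) d) js" "js \<in> tuples r n" by blast
  then show "ks \<in> {ks \<in> tuples r (d * n). d dvd Gcd (set ks)}"
    using assms by (auto simp: tuples_def Gcd_set_map_mult simp del: set_map) auto
qed

lemma card_tuples_gcd_eq:
  assumes "d > 0" "n > 0"
  shows "card {ks \<in> tuples r (d * n). gcd (Gcd (set ks)) (d * n) = d} = jordan_totient r n"
proof -
  have gcd_map: "gcd (Gcd (set (map ((*) d) js))) (d * n) = d * gcd (Gcd (set js)) n" for js
    by (simp only: Gcd_set_map_mult gcd_mult_distrib_nat)
  have "{ks \<in> tuples r (d * n). gcd (Gcd (set ks)) (d * n) = d}
      = {ks \<in> map ((*) d) ` tuples r n. gcd (Gcd (set ks)) (d * n) = d}"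
    \<comment> \<open>The gcd condition already forces \<open>d\<close> to divide every entry, so
      restricting to multiples of \<open>d\<close> loses nothing.\<close>
    unfolding tuples_multiples[OF assms(1), symmetric]
    by (metis (lifting) gcd_dvd1 mem_Collect_eq)
  also have "\<dots> = map ((*) d) ` {js \<in> tuples r n. gcd (Gcd (set js)) n = 1}"
    using assms(1) by (auto simp: gcd_map simp del: set_map)
  finally show ?thesis
    using assms(1)
    by (simp only: jordan_totient_def coprime_iff_gcd_eq_1 card_image inj_on_map_mult)
qed

lemma finite_unitary_divisors: "n \<ge> 1 \<Longrightarrow> finite {d. unitary_divisor d n}"
  by (rule finite_subset[of _ "{..n}"]) (auto simp: unitary_divisor_def dvd_imp_le)

text \<open>Coprimality of \<open>d\<close> and \<open>n div d\<close> is symmetric in the two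
  factors. Together the claims make \<open>n div d\<close> an involution on the unitary divisors,
  which reindexes the sum below.\<close>

lemma unitary_divisor_div:
  assumes "n \<ge> 1" "unitary_divisor d n"
  shows "unitary_divisor (n div d) n" "n div (n div d) = d"
proof -
  obtain e where e: "n = d * e" using assms(2) by (auto simp: unitary_divisor_def)
  moreover have "d > 0" "e > 0" using assms(1) e by (auto intro: Suc_leI)
  ultimately show "unitary_divisor (n div d) n" "n div (n div d) = d"
    using assms(2) by (simp_all add: unitary_divisor_iff_coprime coprime_commute)
qed

lemma regular_count_eq_sum_jordan_totient:
  assumes "n \<ge> 1"
  shows "regular_count r n = (\<Sum>d | unitary_divisor d n. jordan_totient r d)"
proof -
  let ?A = "\<lambda>d. {ks \<in> tuples r n. gcd (Gcd (set ks)) n = d}"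
  have "regular_count r n = card (\<Union>d\<in>{d. unitary_divisor d n}. ?A d)"
    unfolding regular_count_def regular_mod_iff_unitary_divisor[OF assms]
    by (rule arg_cong[where f = card]) auto
  also have "\<dots> = (\<Sum>d | unitary_divisor d n. card (?A d))"
    using finite_unitary_divisors[OF assms] by (intro card_UN_disjoint) auto
  also have "\<dots> = (\<Sum>d | unitary_divisor d n. jordan_totient r (n div d))"
  proof (rule sum.cong)
    fix d assume "d \<in> {d. unitary_divisor d n}"
    then obtain e where "n = d * e" "d > 0" by (auto simp: unitary_divisor_def)
    then show "card (?A d) = jordan_totient r (n div d)"
      using assms card_tuples_gcd_eq[of d e r] by simp
  qed simp
  also have "\<dots> = (\<Sum>d | unitary_divisor d n. jordan_totient r d)"
    by (rule sum.reindex_bij_witness[of _ "\<lambda>d. n div d" "\<lambda>d. n div d"])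
      (use unitary_divisor_div[OF assms] in auto)
  finally show ?thesis .
qed

section \<open>Reducing tuples modulo coprime factors\<close>

definition residue_rep :: "nat \<Rightarrow> nat \<Rightarrow> nat" where
  "residue_rep n k = (if n dvd k then n else k mod n)"

text \<open>The class of 0 is represented by \<open>n\<close>, because entries of
  \<open>tuples\<close> start at 1.\<close>

lemma residue_rep_range: "n \<ge> 1 \<Longrightarrow> residue_rep n k \<in> {1..n}"
  by (auto simp: residue_rep_def dvd_eq_mod_eq_0 Suc_le_eq less_imp_le)

lemma residue_rep_cong: "[residue_rep n k = k] (mod n)"
  by (auto simp: residue_rep_def cong_def dvd_eq_mod_eq_0)

text \<open>Reduction may change the gcd of the entries, but not the joint gcd of all entries and
  \<open>n\<close>: each entry can be replaced separately.\<close>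

lemma gcd_Gcd_map_cong:
  fixes f :: "nat \<Rightarrow> nat"
  assumes "\<And>k. [f k = k] (mod n)"
  shows "gcd (Gcd (set (map f ks))) n = gcd (Gcd (set ks)) n"
proof (induction ks)
  case (Cons k ks)
  have "gcd (f k) n = gcd k n"
    using cong_gcd_eq[OF assms[of k]] by (simp add: gcd.commute)
  then show ?case
    using Cons by (simp add: gcd.assoc) (metis gcd.assoc gcd.commute)
qed simp

lemma residue_rep_tuples:
  assumes "n \<ge> 1" "length ks = r"
  shows "map (residue_rep n) ks \<in> tuples r n"
  unfolding tuples_def using assms(2) residue_rep_range[OF assms(1)]
  by (simp add: image_subset_iff del: atLeastAtMost_iff)

lemma bij_betw_tuples_residues:
  assumes "m \<ge> 1" "n \<ge> 1" "coprime m n"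
  shows "bij_betw (\<lambda>ks. (map (residue_rep m) ks, map (residue_rep n) ks))
    (tuples r (m * n)) (tuples r m \<times> tuples r n)" (is "bij_betw ?f ?A ?B")
proof -
  have rep_inj: "k = l"
    if "k \<in> {1..m * n}" "l \<in> {1..m * n}"
      "residue_rep m k = residue_rep m l" "residue_rep n k = residue_rep n l" for k l
  proof -
    have "[k = l] (mod m)" "[k = l] (mod n)"
      using that(3,4) residue_rep_cong by (metis cong_sym cong_trans)+
    then have "[k = l] (mod m * n)"
      using assms(3) by (rule coprime_cong_mult_nat)
    then have "int (m * n) dvd int k - int l"
      by (simp only: cong_iff_dvd_diff flip: cong_int_iff)
    \<comment> \<open>Two elements of an interval of \<open>m * n\<close> consecutive integers
      differ by less than \<open>m * n\<close>, so divisibility makes the difference 0.\<close>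
    moreover have "\<bar>int k - int l\<bar> < int (m * n)"
      using that(1,2) by (auto simp flip: of_nat_mult)
    ultimately show "k = l"
      using dvd_imp_le_int[of "int k - int l" "int (m * n)"] by auto
  qed
  have "inj_on ?f ?A"
  proof (rule inj_onI)
    fix ks ls assume A: "ks \<in> ?A" "ls \<in> ?A" "?f ks = ?f ls"
    have len: "length ks = length ls" using A(1,2) by (simp add: tuples_def)
    show "ks = ls"
    proof (rule nth_equalityI[OF len])
      fix i assume i: "i < length ks"
      then have "ks ! i \<in> {1..m * n}" "ls ! i \<in> {1..m * n}"
        using A(1,2) len by (auto simp: tuples_def subset_iff simp del: atLeastAtMost_iff)
      moreover have "map (residue_rep m) ks ! i = map (residue_rep m) ls ! i"
        "map (residue_rep n) ks ! i = map (residue_rep n) ls ! i"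
        using A(3) by auto
      ultimately show "ks ! i = ls ! i"
        using i len rep_inj[of "ks ! i" "ls ! i"] by (simp only: nth_map)
    qed
  qed
  moreover have "?f ` ?A \<subseteq> ?B"
    using residue_rep_tuples assms(1,2) by (auto simp: tuples_def[of r "m * n"])
  \<comment> \<open>Surjectivity comes from counting: an injective image in a finite set of the same
    size \<open>(m * n) ^ r\<close> fills it.\<close>
  moreover have "card ?A = card ?B"
    by (simp add: card_cartesian_product card_tuples power_mult_distrib)
  ultimately show ?thesis
    by (simp add: bij_betw_def card_image card_subset_eq)
qed

text \<open>Regularity modulo \<open>n\<close> sees a number only through its gcd with
  \<open>n\<close>, which reduction preserves.\<close>

lemma regular_mod_Gcd_residues:
  assumes "n \<ge> 1"
  shows "regular_mod (int n) (int (Gcd (set (map (residue_rep n) ks))))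
    \<longleftrightarrow> regular_mod (int n) (int (Gcd (set ks)))"
  unfolding regular_mod_iff_unitary_divisor[OF assms] gcd_Gcd_map_cong[OF residue_rep_cong] ..

lemma regular_count_mult:
  assumes "m \<ge> 1" "n \<ge> 1" "coprime m n"
  shows "regular_count r (m * n) = regular_count r m * regular_count r n"
proof -
  let ?R = "\<lambda>n. {ks \<in> tuples r n. regular_mod (int n) (int (Gcd (set ks)))}"
  let ?f = "\<lambda>ks. (map (residue_rep m) ks, map (residue_rep n) ks)"
  note bij = bij_betw_tuples_residues[OF assms, of r]
  \<comment> \<open>The condition on \<open>ks\<close> becomes one condition on each component of
    \<open>?f ks\<close>, so the bijection restricts to the regular tuples.\<close>
  have iff: "regular_mod (int (m * n)) (int (Gcd (set ks))) \<longleftrightarrow>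
      regular_mod (int m) (int (Gcd (set (map (residue_rep m) ks)))) \<and>
      regular_mod (int n) (int (Gcd (set (map (residue_rep n) ks))))" for ks
    unfolding regular_mod_Gcd_residues[OF assms(1)] regular_mod_Gcd_residues[OF assms(2)]
    using assms(3) by (simp add: regular_mod_mult)
  have "?f ` ?R (m * n) = {(js, ls). (js, ls) \<in> ?f ` tuples r (m * n) \<and>
      regular_mod (int m) (int (Gcd (set js))) \<and> regular_mod (int n) (int (Gcd (set ls)))}"
    unfolding iff by (auto simp del: set_map)
  also have "\<dots> = ?R m \<times> ?R n"
    unfolding bij_betw_imp_surj_on[OF bij] by auto
  finally have "?f ` ?R (m * n) = ?R m \<times> ?R n" .
  moreover have "inj_on ?f (?R (m * n))"
    using bij by (auto simp: bij_betw_def intro: inj_on_subset)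
  ultimately have "card (?R (m * n)) = card (?R m \<times> ?R n)"
    using card_image[of ?f "?R (m * n)"] by (simp only:)
  then show ?thesis
    by (simp add: regular_count_def card_cartesian_product)
qed

section \<open>Values at prime powers\<close>

lemma jordan_totient_1 [simp]: "jordan_totient r 1 = 1"
  using card_tuples[of r 1] by (simp add: jordan_totient_def)

text \<open>Coprimality to a power of \<open>p\<close> fails exactly when \<open>p\<close> divides
  every entry, and such tuples are scaled copies of those over \<open>p ^ m\<close>. The additive
  form avoids truncated subtraction.\<close>

lemma jordan_totient_prime_power:
  assumes "prime p"
  shows "jordan_totient r (p ^ Suc m) + p ^ (r * m) = p ^ (r * Suc m)"
proof -
  let ?T = "tuples r (p ^ Suc m)"
  have "p > 0" using assms by (simp add: prime_gt_0_nat)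
  have "coprime g (p ^ Suc m) \<longleftrightarrow> \<not> p dvd g" for g
    using assms by (auto simp: coprime_commute[of g] prime_imp_coprime coprime_absorb_left
        simp del: power_Suc)
  then have "jordan_totient r (p ^ Suc m) = card (?T - {ks \<in> ?T. p dvd Gcd (set ks)})"
    unfolding jordan_totient_def by (intro arg_cong[where f = card]) auto
  also have "\<dots> = card ?T - card {ks \<in> ?T. p dvd Gcd (set ks)}"
    by (intro card_Diff_subset) auto
  finally have "jordan_totient r (p ^ Suc m) = card ?T - card {ks \<in> ?T. p dvd Gcd (set ks)}" .
  moreover have "card {ks \<in> ?T. p dvd Gcd (set ks)} = p ^ (r * m)"
    using \<open>p > 0\<close> tuples_multiples[of p r "p ^ m"]
    by (simp add: card_image inj_on_map_mult card_tuples mult.commute flip: power_mult)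
  moreover have "card ?T = p ^ (r * Suc m)"
    by (metis card_tuples mult.commute power_mult)
  moreover have "p ^ (r * m) \<le> p ^ (r * Suc m)"
    using \<open>p > 0\<close> by (intro power_increasing) auto
  ultimately show ?thesis by simp
qed

lemma unitary_divisors_prime_power:
  assumes "prime p"
  shows "{d. unitary_divisor d (p ^ m)} = {1, p ^ m}"
proof (intro equalityI subsetI)
  fix d assume "d \<in> {d. unitary_divisor d (p ^ m)}"
  then have d: "d dvd p ^ m" "coprime d (p ^ m div d)"
    by (auto simp: unitary_divisor_iff_coprime)
  then obtain i where i: "i \<le> m" "d = p ^ i"
    using assms divides_primepow_nat by blast
  have "p ^ m div d = p ^ (m - i)"
    using assms i by (simp add: power_diff prime_gt_0_nat)
  \<comment> \<open>For \<open>0 < i < m\<close> the prime \<open>p\<close> would divide both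
    \<open>p ^ i\<close> and \<open>p ^ (m - i)\<close>.\<close>
  then have "i = 0 \<or> i = m"
    using d(2) i assms by (cases "i = 0 \<or> i = m") auto
  then show "d \<in> {1, p ^ m}" using i by auto
qed (use assms in \<open>auto simp: unitary_divisor_def Suc_le_eq prime_gt_0_nat\<close>)

lemma regular_count_prime_power:
  assumes "prime p" "\<nu> \<ge> 1"
  shows "int (regular_count r (p ^ \<nu>)) = int p ^ (r * \<nu>) - int p ^ (r * (\<nu> - 1)) + 1"
proof -
  obtain m where m: "\<nu> = Suc m" using assms(2) by (cases \<nu>) auto
  \<comment> \<open>This keeps the divisors 1 and \<open>p ^ \<nu>\<close> distinct, so the sum
    really has two terms.\<close>
  have "p ^ \<nu> > 1" using prime_gt_1_nat[OF assms(1)] assms(2) by (intro one_less_power) auto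
  then have "regular_count r (p ^ \<nu>) = 1 + jordan_totient r (p ^ \<nu>)"
    by (simp add: regular_count_eq_sum_jordan_totient unitary_divisors_prime_power[OF assms(1)]
        del: One_nat_def)
  moreover have "int (jordan_totient r (p ^ \<nu>)) + int p ^ (r * m) = int p ^ (r * \<nu>)"
    using jordan_totient_prime_power[OF assms(1), of r m]
    unfolding m by (metis of_nat_add of_nat_power)
  ultimately show ?thesis by (simp add: m)
qed

theorem proposition2p1:
  shows "(\<forall>r\<ge>1. \<forall>n\<ge>1.
            regular_count r n = (\<Sum>d | unitary_divisor d n. jordan_totient r d)) \<and>
         (\<forall>r\<ge>1.
            multiplicative_arith (regular_count r) \<and>
            (\<forall>(p::nat) \<nu>. prime p \<longrightarrow> \<nu> \<ge> 1 \<longrightarrow>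
               int (regular_count r (p ^ \<nu>)) =
                 int p ^ (r * \<nu>) - int p ^ (r * (\<nu> - 1)) + 1))"
proof -
  \<comment> \<open>Modulo 1 everything is regular, and the only tuple is constantly 1.\<close>
  have "regular_count r 1 = 1" for r
    using card_tuples[of r 1] by (simp add: regular_count_def regular_mod_def)
  then have "multiplicative_arith (regular_count r)" for r
    unfolding multiplicative_arith_def by (metis coprime_iff_gcd_eq_1 regular_count_mult)
  then show ?thesis
    by (simp add: regular_count_eq_sum_jordan_totient regular_count_prime_power)
qed

end
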